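(* Let $\varepsilon>0$. There exists a constant $c_\varepsilon>0$ such that the following holds: for all integers $n\ge1$ and $r\ge1$ and every non-trivial word $w\in\mathbb F_r$ of length $l$, we have $$d(\mu^{S_n}_{w},\mu^{S_n}_{\rm unif})\le c_\varepsilon\, l^2\, n^{-1/3+\varepsilon},$$ where $d$ denotes the Kantorovich-Rubinstein metric on ${\rm P}(S_n)$ associated with the normalized Hamming metric.
   Context: $S_n$ is the symmetric group on $\{1,\dots,n\}$ and $\mathbb F_r=\langle x_1,\dots,x_r\rangle$ is the free group of rank $r$; the length of $w\in\mathbb F_r$ is its reduced word length with respect to $x_1,\dots,x_r$. For $w\in\mathbb F_r$, the word map $w\colon S_n^r\to S_n$ is given by substituting $\sigma_i$ for $x_i$, and $\mu^{S_n}_w$ is the push-forward under this map of the normalized counting measure on $S_n^r$. The uniform probability measure on $S_n$ is $\mu^{S_n}_{\rm unif}$, and ${\rm P}(X)$ denotes the set of probability measures on a finite set $X$. The normalized Hamming metric on $S_n$ is $d(\sigma,\tau)=\frac1n|\{i\in\{1,\dots,n\}\mid\sigma(i)\ne\tau(i)\}|$. The Kantorovich-Rubinstein metric on ${\rm P}(S_n)$ is $$d(\mu,\nu)=\min\Big\{\int d(\sigma,\tau)\,d\gamma(\sigma,\tau)\ \Big|\ \gamma\in{\rm P}(S_n\times S_n),\ \pi_{1,*}(\gamma)=\mu,\ \pi_{2,*}(\gamma)=\nu\Big\},$$ where $\pi_1,\pi_2$ are the coordinate projections. *)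

theory Defs
  imports "HOL-Algebra.Sym_Groups" "HOL-Probability.Probability"
begin

text \<open>
  The free group on \<open>x\<^sub>1, \<dots>, x\<^sub>r\<close> in its normal-form model: the elements are the reduced
  words, so that \<open>length w\<close> is the reduced word length of \<open>w\<close>. The letter \<open>(i, True)\<close> stands
  for \<open>x\<^sub>i\<close> and \<open>(i, False)\<close> for its inverse.
\<close>

type_synonym letter = "nat \<times> bool"

definition inv_letter :: "letter \<Rightarrow> letter" where
  "inv_letter a = (fst a, \<not> snd a)"

definition reduced :: "letter list \<Rightarrow> bool" where
  "reduced w \<longleftrightarrow> successively (\<lambda>a b. b \<noteq> inv_letter a) w"

fun red_cons :: "letter \<Rightarrow> letter list \<Rightarrow> letter list" where
  "red_cons a [] = [a]"
| "red_cons a (b # w) = (if b = inv_letter a then w else a # b # w)"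

definition free_group :: "nat \<Rightarrow> letter list monoid" where
  "free_group r =
     \<lparr>carrier = {w. reduced w \<and> fst ` set w \<subseteq> {1..r}},
      mult = (\<lambda>u v. foldr red_cons u v), one = []\<rparr>"

definition word_map :: "('a, 'm) monoid_scheme \<Rightarrow> letter list \<Rightarrow> (nat \<Rightarrow> 'a) \<Rightarrow> 'a" where
  "word_map G w \<sigma> =
     foldr (\<lambda>a g. (if snd a then \<sigma> (fst a) else inv\<^bsub>G\<^esub> (\<sigma> (fst a))) \<otimes>\<^bsub>G\<^esub> g) w \<one>\<^bsub>G\<^esub>"

definition word_measure :: "nat \<Rightarrow> nat \<Rightarrow> letter list \<Rightarrow> (nat \<Rightarrow> nat) pmf" where
  "word_measure n r w =
     map_pmf (word_map (sym_group n) w) (pmf_of_set ({1..r} \<rightarrow>\<^sub>E carrier (sym_group n)))"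

definition unif_measure :: "nat \<Rightarrow> (nat \<Rightarrow> nat) pmf" where
  "unif_measure n = pmf_of_set (carrier (sym_group n))"

definition hamming_dist :: "nat \<Rightarrow> (nat \<Rightarrow> nat) \<Rightarrow> (nat \<Rightarrow> nat) \<Rightarrow> real" where
  "hamming_dist n \<sigma> \<tau> = real (card {i \<in> {1..n}. \<sigma> i \<noteq> \<tau> i}) / real n"

text \<open>
  \<open>X\<close> is the underlying finite set and \<open>d\<close> its metric; elements of \<open>P(X)\<close> are the
  probability mass functions supported in \<open>X\<close>. The minimum over couplings is written as an
  infimum, with which it agrees: for finite \<open>X\<close> it is attained, by compactness.
\<close>

definition KR_dist :: "'a set \<Rightarrow> ('a \<Rightarrow> 'a \<Rightarrow> real) \<Rightarrow> 'a pmf \<Rightarrow> 'a pmf \<Rightarrow> real" where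
  "KR_dist X d \<mu> \<nu> =
     Inf {measure_pmf.expectation \<gamma> (\<lambda>(\<sigma>, \<tau>). d \<sigma> \<tau>) | \<gamma>.
            set_pmf \<gamma> \<subseteq> X \<times> X \<and> map_pmf fst \<gamma> = \<mu> \<and> map_pmf snd \<gamma> = \<nu>}"


subsection \<open>The free group is a group, and word maps are its evaluation homomorphisms\<close>

lemma inv_letter_inv_letter [simp]: "inv_letter (inv_letter a) = a"
  by (simp add: inv_letter_def)

lemma fst_inv_letter [simp]: "fst (inv_letter a) = fst a"
  by (simp add: inv_letter_def)

lemma reduced_Nil [simp]: "reduced []"
  by (simp add: reduced_def)

lemma reduced_ConsD: "reduced (a # w) \<Longrightarrow> reduced w"
  by (cases w) (auto simp: reduced_def)

lemma reduced_red_cons: "reduced w \<Longrightarrow> reduced (red_cons a w)"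
  by (cases w) (auto simp: reduced_def successively_Cons)

lemma set_red_cons: "set (red_cons a w) \<subseteq> insert a (set w)"
  by (cases w) auto

lemma red_cons_inv: "reduced w \<Longrightarrow> red_cons a (red_cons (inv_letter a) w) = w"
proof (cases w)
  case (Cons b v)
  assume "reduced w"
  with Cons show ?thesis by (cases v) (auto simp: reduced_def)
qed auto

lemma red_cons_inv': "reduced w \<Longrightarrow> red_cons (inv_letter a) (red_cons a w) = w"
  using red_cons_inv[of w "inv_letter a"] by simp

lemma reduced_foldr: "reduced v \<Longrightarrow> reduced (foldr red_cons u v)"
  by (induction u) (auto simp: reduced_red_cons)

lemma set_foldr: "set (foldr red_cons u v) \<subseteq> set u \<union> set v"
proof (induction u)
  case (Cons a u)
  then show ?case using set_red_cons[of a "foldr red_cons u v"] by auto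
qed simp

lemma foldr_red_cons:
  "reduced w \<Longrightarrow> foldr red_cons (red_cons a v) w = red_cons a (foldr red_cons v w)"
  by (cases v) (auto simp: red_cons_inv reduced_foldr)

lemma foldr_assoc:
  "reduced w \<Longrightarrow> foldr red_cons (foldr red_cons u v) w = foldr red_cons u (foldr red_cons v w)"
  by (induction u) (auto simp: foldr_red_cons)

lemma foldr_reduced_Nil: "reduced u \<Longrightarrow> foldr red_cons u [] = u"
proof (induction u)
  case (Cons a u)
  then have "foldr red_cons u [] = u" using reduced_ConsD by blast
  with Cons.prems show ?case by (cases u) (auto simp: reduced_def)
qed simp

lemma foldr_inverse:
  "reduced v \<Longrightarrow> foldr red_cons (rev (map inv_letter u)) (foldr red_cons u v) = v"
  by (induction u) (auto simp: red_cons_inv' reduced_foldr)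

lemma reduced_inverse: "reduced u \<Longrightarrow> reduced (rev (map inv_letter u))"
  unfolding reduced_def successively_rev successively_map
  by (erule successively_mono) (metis inv_letter_inv_letter)

lemma group_free_group: "group (free_group r)"
proof (rule groupI)
  fix u v assume "u \<in> carrier (free_group r)" "v \<in> carrier (free_group r)"
  then show "u \<otimes>\<^bsub>free_group r\<^esub> v \<in> carrier (free_group r)"
    using set_foldr[of u v] by (fastforce simp: free_group_def reduced_foldr)
next
  fix u assume u: "u \<in> carrier (free_group r)"
  have "foldr red_cons (rev (map inv_letter u)) u = []"
    using u foldr_inverse[of "[]" u] foldr_reduced_Nil[of u] by (simp add: free_group_def)
  moreover have "rev (map inv_letter u) \<in> carrier (free_group r)"
    using u by (auto simp: free_group_def reduced_inverse image_image)
  ultimately show "\<exists>v\<in>carrier (free_group r). v \<otimes>\<^bsub>free_group r\<^esub> u = \<one>\<^bsub>free_group r\<^esub>"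
    by (intro bexI[of _ "rev (map inv_letter u)"]) (auto simp: free_group_def)
qed (auto simp: free_group_def foldr_assoc)

context group
begin

lemma word_map_Nil [simp]: "word_map G [] \<sigma> = \<one>"
  by (simp add: word_map_def)

lemma word_map_Cons:
  "word_map G (a # w) \<sigma> = (if snd a then \<sigma> (fst a) else inv (\<sigma> (fst a))) \<otimes> word_map G w \<sigma>"
  by (simp add: word_map_def)

lemma word_map_closed:
  "\<sigma> \<in> I \<rightarrow> carrier G \<Longrightarrow> fst ` set w \<subseteq> I \<Longrightarrow> word_map G w \<sigma> \<in> carrier G"
  by (induction w) (auto simp: word_map_Cons)

lemma word_map_red_cons:
  assumes \<sigma>: "\<sigma> \<in> I \<rightarrow> carrier G" and I: "fst a \<in> I" "fst ` set w \<subseteq> I"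
  shows "word_map G (red_cons a w) \<sigma> = word_map G (a # w) \<sigma>"
proof (cases w)
  case (Cons b v)
  have "word_map G v \<sigma> \<in> carrier G" "\<sigma> (fst a) \<in> carrier G"
    using assms Cons word_map_closed[of \<sigma> I v] by auto
  then show ?thesis
    using Cons by (auto simp: word_map_Cons inv_letter_def m_assoc[symmetric])
qed simp

lemma word_map_foldr:
  assumes "\<sigma> \<in> I \<rightarrow> carrier G" "fst ` set u \<subseteq> I" "fst ` set v \<subseteq> I"
  shows "word_map G (foldr red_cons u v) \<sigma> = word_map G u \<sigma> \<otimes> word_map G v \<sigma>"
  using assms
proof (induction u)
  case Nil
  then show ?case using word_map_closed[of \<sigma> I v] by simp
next
  case (Cons a u)
  have "fst ` set (foldr red_cons u v) \<subseteq> I"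
    using set_foldr[of u v] Cons.prems by fastforce
  moreover have "word_map G u \<sigma> \<in> carrier G" "word_map G v \<sigma> \<in> carrier G" "\<sigma> (fst a) \<in> carrier G"
    using Cons.prems word_map_closed[of \<sigma> I] by auto
  ultimately show ?case
    using Cons word_map_red_cons[of \<sigma> I a "foldr red_cons u v"]
    by (auto simp: word_map_Cons m_assoc)
qed

lemma word_map_hom:
  assumes "\<sigma> \<in> {1..r} \<rightarrow> carrier G"
  shows "(\<lambda>w. word_map G w \<sigma>) \<in> hom (free_group r) G"
  using assms word_map_foldr[OF assms] word_map_closed[OF assms]
  by (auto simp: hom_def free_group_def)

lemma word_map_generator: "\<sigma> i \<in> carrier G \<Longrightarrow> word_map G [(i, True)] \<sigma> = \<sigma> i"
  by (simp add: word_map_Cons)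

end

end

theory Submission
  imports Defs
begin

text \<open>
  Most elements of \<open>S\<^sub>n\<close> have few cycles, and a permutation with few cycles is, up to conjugation,
  close in the Hamming metric to the \<open>n\<close>-cycle \<open>(1 2 \<dots> n)\<close>: listing its cycles one after
  another, one error is made per cycle. Two conjugation-invariant measures can therefore be
  coupled by normalizing independent samples of both and then conjugating the normal forms by the same
  uniformly random permutation; the cost is at most the sum of the expected numbers of cycles, divided by \<open>n\<close>
  (\<open>exists_conjugate_near_successor\<close>, \<open>KR_dist_conjugation_invariant_le\<close>). Word measures are
  conjugation-invariant, and the uniform measure is the word measure of a single generator, so it
  remains to bound the expected number of cycles of the value of a word.

  There are at most \<open>n / L\<close> cycles longer than \<open>L\<close>, and at most as many others as there are points in them. After
  cyclic reduction of the word, which only conjugates its value, a point in a cycle of length at most \<open>L\<close> has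
  a trajectory under the \<open>L\<close>-th power of the word, a reduced word of length at most \<open>T = L * l\<close>, that
  visits some point twice. Once a random substitution has led to \<open>s\<close> distinct points, the next step of a
  reduced word is at least as likely to lead to any given fresh point as to any other point, so it hits a
  visited point with probability at most \<open>s / n\<close>; hence a repetition occurs with probability at most
  \<open>T (T + 1) / (2 n)\<close> (\<open>card_simple_substitutions_Cons\<close>, \<open>card_simple_substitutions_ge\<close>). Thus the
  distance is at most \<open>2 / L + 2 L\<^sup>2 l\<^sup>2 / n\<close>, and \<open>L\<close> is chosen of order \<open>n\<close> to the power \<open>1 / 3\<close>.
\<close>

section \<open>Trajectories of a point under a word\<close>

abbreviation substitutions :: "nat \<Rightarrow> nat \<Rightarrow> (nat \<Rightarrow> nat \<Rightarrow> nat) set" where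
  "substitutions n r \<equiv> {1..r} \<rightarrow>\<^sub>E carrier (sym_group n)"

definition act :: "(nat \<Rightarrow> 'a \<Rightarrow> 'a) \<Rightarrow> letter \<Rightarrow> 'a \<Rightarrow> 'a" where
  "act \<sigma> a = (if snd a then \<sigma> (fst a) else inv' (\<sigma> (fst a)))"

text \<open>
  The successive positions of the point \<open>x\<close> under the letters of a word. The last letter of the word
  acts first, so the list is in reverse chronological order: its head is the current position and
  its last entry the starting point.
\<close>

primrec trajectory :: "(nat \<Rightarrow> 'a \<Rightarrow> 'a) \<Rightarrow> letter list \<Rightarrow> 'a \<Rightarrow> 'a list" where
  "trajectory \<sigma> [] x = [x]"
| "trajectory \<sigma> (a # v) x = act \<sigma> a (hd (trajectory \<sigma> v x)) # trajectory \<sigma> v x"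

lemma length_trajectory [simp]: "length (trajectory \<sigma> v x) = Suc (length v)"
  by (induction v) auto

lemma trajectory_neq_Nil [simp]: "trajectory \<sigma> v x \<noteq> []"
  by (cases v) auto

lemma last_trajectory [simp]: "last (trajectory \<sigma> v x) = x"
  by (induction v) auto

lemma trajectory_append:
  "trajectory \<sigma> (u @ v) x = butlast (trajectory \<sigma> u (hd (trajectory \<sigma> v x))) @ trajectory \<sigma> v x"
proof (induction u)
  case (Cons a u)
  define h where "h = hd (trajectory \<sigma> v x)"
  have "hd (butlast P @ Q) = hd P" if "P \<noteq> []" "last P = hd Q" for P Q :: "'a list"
    using that by (cases P) auto
  from this[of "trajectory \<sigma> u h" "trajectory \<sigma> v x"]
  have "hd (trajectory \<sigma> (u @ v) x) = hd (trajectory \<sigma> u h)"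
    using Cons by (simp add: h_def)
  then show ?case using Cons by (simp add: h_def)
qed simp

lemma permutes_substitution:
  assumes "\<sigma> \<in> substitutions n r" "i \<in> {1..r}"
  shows "\<sigma> i permutes {1..n}"
  using assms by (auto simp: sym_group_carrier PiE_iff)

lemma act_permutes:
  assumes "\<sigma> \<in> substitutions n r" "fst a \<in> {1..r}"
  shows "act \<sigma> a permutes {1..n}"
  using permutes_substitution[OF assms] by (auto simp: act_def permutes_inv)

lemma word_map_sym_group_Cons:
  assumes "\<sigma> \<in> substitutions n r" "fst a \<in> {1..r}"
  shows "word_map (sym_group n) (a # v) \<sigma> = act \<sigma> a \<circ> word_map (sym_group n) v \<sigma>"
  using assms by (auto simp: group.word_map_Cons[OF sym_group_is_group] act_def sym_group_mult PiE_iff)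

lemma word_map_sym_group_Nil: "word_map (sym_group n) [] \<sigma> = id"
  by (simp add: group.word_map_Nil[OF sym_group_is_group] sym_group_one)

lemma word_map_permutes:
  assumes "\<sigma> \<in> substitutions n r" "fst ` set v \<subseteq> {1..r}"
  shows "word_map (sym_group n) v \<sigma> permutes {1..n}"
  using group.word_map_closed[OF sym_group_is_group, of \<sigma> "{1..r}" n v] assms
  by (auto simp: sym_group_carrier PiE_iff)

lemma hd_trajectory:
  assumes "\<sigma> \<in> substitutions n r" "fst ` set v \<subseteq> {1..r}"
  shows "hd (trajectory \<sigma> v x) = word_map (sym_group n) v \<sigma> x"
  using assms(2)
  by (induction v) (auto simp: word_map_sym_group_Nil word_map_sym_group_Cons[OF assms(1)])

lemma set_trajectory:
  assumes "\<sigma> \<in> substitutions n r" "fst ` set v \<subseteq> {1..r}" "x \<in> {1..n}"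
  shows "set (trajectory \<sigma> v x) \<subseteq> {1..n}"
  using assms(2)
proof (induction v)
  case (Cons a v)
  then have "set (trajectory \<sigma> v x) \<subseteq> {1..n}" by simp
  then have "hd (trajectory \<sigma> v x) \<in> {1..n}"
    using hd_in_set[OF trajectory_neq_Nil[of \<sigma> v x]] by blast
  then show ?case
    using Cons permutes_in_image[OF act_permutes[OF assms(1), of a]] by auto
qed (use assms in auto)

section \<open>Self-avoiding trajectories\<close>

text \<open>
  Composing one generator with the transposition of \<open>y\<close> and \<open>z\<close>, on the side that makes the letter
  \<open>a\<close> (which may be an inverse generator) send to \<open>y\<close> whatever it used to send to \<open>z\<close>, and vice versa.
\<close>

definition redirect :: "(nat \<Rightarrow> 'a \<Rightarrow> 'a) \<Rightarrow> letter \<Rightarrow> 'a \<Rightarrow> 'a \<Rightarrow> (nat \<Rightarrow> 'a \<Rightarrow> 'a)" where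
  "redirect \<sigma> a y z =
     \<sigma>(fst a := if snd a then Transposition.transpose y z \<circ> \<sigma> (fst a) else \<sigma> (fst a) \<circ> Transposition.transpose y z)"

lemma act_redirect_same:
  "bij (\<sigma> (fst a)) \<Longrightarrow> act (redirect \<sigma> a y z) a = Transposition.transpose y z \<circ> act \<sigma> a"
  by (auto simp: act_def redirect_def o_inv_distrib)

lemma act_redirect_inv_letter:
  "bij (\<sigma> (fst a)) \<Longrightarrow> act (redirect \<sigma> a y z) (inv_letter a) = act \<sigma> (inv_letter a) \<circ> Transposition.transpose y z"
  by (auto simp: act_def redirect_def inv_letter_def o_inv_distrib)

lemma act_redirect_other: "fst b \<noteq> fst a \<Longrightarrow> act (redirect \<sigma> a y z) b = act \<sigma> b"
  by (auto simp: act_def redirect_def)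

lemma redirect_redirect: "redirect (redirect \<sigma> a y z) a y z = \<sigma>"
proof (rule ext)
  fix i
  show "redirect (redirect \<sigma> a y z) a y z i = \<sigma> i"
    by (auto simp: redirect_def fun_eq_iff)
qed

lemma redirect_in_substitutions:
  assumes "\<sigma> \<in> substitutions n r" "fst a \<in> {1..r}" "y \<in> {1..n}" "z \<in> {1..n}"
  shows "redirect \<sigma> a y z \<in> substitutions n r"
proof (rule PiE_I)
  fix i assume "i \<in> {1..r}"
  then show "redirect \<sigma> a y z i \<in> carrier (sym_group n)"
    using permutes_substitution[OF assms(1), of i] permutes_swap_id[OF assms(3,4)]
    by (auto simp: redirect_def sym_group_carrier permutes_compose)
next
  fix i assume "i \<notin> {1..r}"
  then show "redirect \<sigma> a y z i = undefined"
    using assms(1,2) by (auto simp: redirect_def PiE_iff extensional_def)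
qed

lemma act_inv_letter_act:
  "bij (\<sigma> (fst a)) \<Longrightarrow> act \<sigma> (inv_letter a) (act \<sigma> a p) = p"
  by (auto simp: act_def inv_letter_def bij_is_inj bij_is_surj surj_f_inv_f)

text \<open>
  A redirection of the next step into a fresh point \<open>y\<close> does not disturb the steps already made.
  A former step along \<open>a\<close> ends neither at \<open>y\<close>, which is fresh, nor at \<open>z\<close>, whose only \<open>a\<close>-preimage is
  the current position, from which no former step starts. A former step along the inverse of \<open>a\<close> starts neither at
  \<open>y\<close> nor at \<open>z\<close>: a start at \<open>z\<close> would lead to the current position, so this would be the most recent step,
  against the word being reduced.
\<close>

lemma trajectory_redirect:
  assumes bij: "\<And>i. i \<in> fst ` set (a # v) \<Longrightarrow> bij (\<sigma> i)"
    and red: "reduced (a # v)"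
    and dist: "distinct (trajectory \<sigma> v x)"
    and y: "y \<notin> set (trajectory \<sigma> v x)"
    and z: "z = act \<sigma> a (hd (trajectory \<sigma> v x))"
  shows "trajectory (redirect \<sigma> a y z) v x = trajectory \<sigma> v x"
proof -
  have bija: "bij (\<sigma> (fst a))" using bij by simp
  have "trajectory (redirect \<sigma> a y z) s x = trajectory \<sigma> s x" if "v = u @ s" for u s
    using that
  proof (induction s arbitrary: u)
    case (Cons b s)
    define p where "p = hd (trajectory \<sigma> s x)"
    have IH: "trajectory (redirect \<sigma> a y z) s x = trajectory \<sigma> s x"
      using Cons.IH[of "u @ [b]"] Cons.prems by simp
    have pv: "trajectory \<sigma> v x = butlast (trajectory \<sigma> u (act \<sigma> b p)) @ act \<sigma> b p # trajectory \<sigma> s x"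
      using Cons.prems trajectory_append[of \<sigma> u "b # s" x] by (simp add: p_def)
    have p: "p \<in> set (trajectory \<sigma> s x)" by (simp add: p_def)
    have ne: "p \<noteq> hd (trajectory \<sigma> v x)"
      using dist p unfolding pv by (cases "butlast (trajectory \<sigma> u (act \<sigma> b p))") auto
    have py: "p \<noteq> y" "act \<sigma> b p \<noteq> y" using y p unfolding pv by auto
    have "act (redirect \<sigma> a y z) b p = act \<sigma> b p"
    proof -
      consider "fst b \<noteq> fst a" | "b = a" | "b = inv_letter a"
        by (cases a, cases b) (auto simp: inv_letter_def)
      then show ?thesis
      proof cases
        case 2
        have "act \<sigma> a p \<noteq> z"
          using ne act_inv_letter_act[of \<sigma> a, OF bija] unfolding z by metis
        then show ?thesis
          using 2 py bija by (simp add: act_redirect_same)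
      next
        case 3
        have "p \<noteq> z"
        proof
          assume "p = z"
          then have eq: "act \<sigma> b p = hd (trajectory \<sigma> v x)"
            using act_inv_letter_act[of \<sigma> a, OF bija] 3 z by metis
          have "butlast (trajectory \<sigma> u (act \<sigma> b p)) = []"
            using eq dist unfolding pv by (cases "butlast (trajectory \<sigma> u (act \<sigma> b p))") auto
          then have "u = []"
            using length_butlast[of "trajectory \<sigma> u (act \<sigma> b p)"] by simp
          then show False
            using Cons.prems red 3 by (simp add: reduced_def)
        qed
        then show ?thesis
          using 3 py bija by (simp add: act_redirect_inv_letter)
      qed (simp add: act_redirect_other)
    qed
    then show ?case using IH by (simp add: p_def)
  qed simp
  from this[of "[]" v] show ?thesis by simp
qed

definition simple_substitutions :: "nat \<Rightarrow> nat \<Rightarrow> letter list \<Rightarrow> nat \<Rightarrow> (nat \<Rightarrow> nat \<Rightarrow> nat) set" where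
  "simple_substitutions n r v x = {\<sigma> \<in> substitutions n r. distinct (trajectory \<sigma> v x)}"

lemma finite_substitutions: "finite (substitutions n r)"
  by (intro finite_PiE) (simp_all add: sym_group_def finite_permutations del: One_nat_def)

lemma substitutions_nonempty: "substitutions n r \<noteq> {}"
  using monoid.one_closed[OF group.is_monoid[OF sym_group_is_group[of n]]]
  by (metis PiE_eq_empty_iff empty_iff)

text \<open>
  An injection gives the inequality: a simple substitution for \<open>v\<close> together with a point \<open>y\<close> not yet
  visited is sent to the substitution whose next step is redirected into \<open>y\<close>, together with the
  original endpoint of that step, which suffices to undo the redirection. In terms of probabilities:
  given that no point has been visited twice so far, the next step avoids the \<open>length v + 1\<close> visited
  points with probability at least \<open>1 - (length v + 1) / n\<close>.
\<close>

lemma card_simple_substitutions_Cons: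
  assumes red: "reduced (a # v)" and ran: "fst ` set (a # v) \<subseteq> {1..r}" and x: "x \<in> {1..n}"
  shows "card (simple_substitutions n r v x) * (n - Suc (length v))
           \<le> card (simple_substitutions n r (a # v) x) * n"
proof -
  define pairs where "pairs = (SIGMA \<sigma>:simple_substitutions n r v x. {1..n} - set (trajectory \<sigma> v x))"
  define endpoint where "endpoint \<sigma> = act \<sigma> a (hd (trajectory \<sigma> v x))" for \<sigma> :: "nat \<Rightarrow> nat \<Rightarrow> nat"
  define \<phi> where "\<phi> = (\<lambda>(\<sigma>, y). (redirect \<sigma> a y (endpoint \<sigma>), endpoint \<sigma>))"
  have bij: "bij (\<sigma> i)" if "\<sigma> \<in> substitutions n r" "i \<in> fst ` set (a # v)" for \<sigma> i
    using permutes_bij[OF permutes_substitution[OF that(1)]] that(2) ran by blast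
  have simpleD: "\<sigma> \<in> substitutions n r" "distinct (trajectory \<sigma> v x)"
    if "\<sigma> \<in> simple_substitutions n r v x" for \<sigma>
    using that by (auto simp: simple_substitutions_def)
  have trajectory_eq: "trajectory (redirect \<sigma> a y (endpoint \<sigma>)) v x = trajectory \<sigma> v x"
    if "(\<sigma>, y) \<in> pairs" for \<sigma> y
  proof -
    from that have \<sigma>: "\<sigma> \<in> simple_substitutions n r v x" and y: "y \<notin> set (trajectory \<sigma> v x)"
      by (auto simp: pairs_def)
    show ?thesis
      using bij[OF simpleD(1)[OF \<sigma>]] red simpleD(2)[OF \<sigma>] y
      by (intro trajectory_redirect) (simp_all add: endpoint_def)
  qed
  have endpoint_eq: "endpoint (redirect \<sigma> a y (endpoint \<sigma>)) = y"
    if "(\<sigma>, y) \<in> pairs" for \<sigma> y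
  proof -
    have "\<sigma> \<in> simple_substitutions n r v x"
      using that by (auto simp: pairs_def)
    then show ?thesis
      using bij[OF simpleD(1), of \<sigma> "fst a"] trajectory_eq[OF that]
      by (simp add: endpoint_def act_redirect_same)
  qed
  have endpoint_in: "endpoint \<sigma> \<in> {1..n}" if "\<sigma> \<in> substitutions n r" for \<sigma>
    using set_trajectory[OF that, of "a # v" x] ran x by (auto simp: endpoint_def)
  have "inj_on \<phi> pairs"
  proof (rule inj_onI, clarify)
    fix \<sigma> y \<tau> y'
    assume *: "(\<sigma>, y) \<in> pairs" "(\<tau>, y') \<in> pairs" "\<phi> (\<sigma>, y) = \<phi> (\<tau>, y')"
    then have e: "endpoint \<sigma> = endpoint \<tau>"
        and r: "redirect \<sigma> a y (endpoint \<sigma>) = redirect \<tau> a y' (endpoint \<tau>)"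
      by (auto simp: \<phi>_def)
    have "y = y'" using endpoint_eq[OF *(1)] endpoint_eq[OF *(2)] r by simp
    with e r show "\<sigma> = \<tau> \<and> y = y'" using redirect_redirect by metis
  qed
  moreover have "\<phi> ` pairs \<subseteq> simple_substitutions n r (a # v) x \<times> {1..n}"
  proof (rule image_subsetI)
    fix e assume "e \<in> pairs"
    then obtain \<sigma> y where e: "e = (\<sigma>, y)" and *: "(\<sigma>, y) \<in> pairs" by (cases e) auto
    then have \<sigma>: "\<sigma> \<in> substitutions n r" "distinct (trajectory \<sigma> v x)"
        and y: "y \<in> {1..n}" "y \<notin> set (trajectory \<sigma> v x)"
      using simpleD by (auto simp: pairs_def)
    show "\<phi> e \<in> simple_substitutions n r (a # v) x \<times> {1..n}"
      using redirect_in_substitutions[OF \<sigma>(1) _ y(1) endpoint_in[OF \<sigma>(1)], of a] ran \<sigma> y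
        endpoint_in[OF \<sigma>(1)] trajectory_eq[OF *] endpoint_eq[OF *]
      by (simp add: e \<phi>_def simple_substitutions_def endpoint_def)
  qed
  moreover have fin: "finite (simple_substitutions n r u x)" for u
    by (rule finite_subset[OF _ finite_substitutions[of r n]]) (auto simp: simple_substitutions_def)
  ultimately have "card pairs \<le> card (simple_substitutions n r (a # v) x \<times> {1..n})"
    by (intro card_inj_on_le[of \<phi>]) auto
  moreover have "card pairs = card (simple_substitutions n r v x) * (n - Suc (length v))"
  proof -
    have "card ({1..n} - set (trajectory \<sigma> v x)) = n - Suc (length v)"
      if "\<sigma> \<in> simple_substitutions n r v x" for \<sigma>
      using set_trajectory[OF simpleD(1)[OF that], of v x] ran x distinct_card[OF simpleD(2)[OF that]]
      by (simp add: card_Diff_subset)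
    then show ?thesis
      by (simp add: pairs_def card_SigmaI fin)
  qed
  ultimately show ?thesis by (simp add: card_cartesian_product)
qed

text \<open>
  Union bound over the steps, the failure probabilities \<open>s / n\<close> for \<open>s = 1, \<dots>, length v\<close> being added up.
\<close>

lemma card_simple_substitutions_ge:
  assumes "reduced v" "fst ` set v \<subseteq> {1..r}" and x: "x \<in> {1..n}"
  shows "real (card (simple_substitutions n r v x))
           \<ge> (1 - real (length v * Suc (length v)) / (2 * real n)) * real (card (substitutions n r))"
  using assms(1,2)
proof (induction v)
  case Nil
  then show ?case by (simp add: simple_substitutions_def)
next
  case (Cons a v)
  define A where "A = real (card (simple_substitutions n r v x))"
  define B where "B = real (card (simple_substitutions n r (a # v) x))"
  define N where "N = real (card (substitutions n r))"
  define t where "t = real (length v)"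
  have n: "real n > 0" using x by simp
  have AN: "A \<le> N"
    unfolding A_def N_def
    using card_mono[OF finite_substitutions[of r n], of "simple_substitutions n r v x"]
    by (auto simp: simple_substitutions_def)
  have IH: "A \<ge> (1 - t * (t + 1) / (2 * real n)) * N"
    using Cons.IH Cons.prems reduced_ConsD by (auto simp: A_def N_def t_def algebra_simps)
  have "A * (real n - (t + 1)) \<le> A * real (n - Suc (length v))"
    by (intro mult_left_mono) (auto simp: A_def t_def)
  also have "\<dots> \<le> B * real n"
    using card_simple_substitutions_Cons[OF Cons.prems x] unfolding A_def B_def
    by (metis of_nat_le_iff of_nat_mult)
  finally have "A - A * (t + 1) / real n \<le> B"
    using n by (simp add: field_simps)
  moreover have "A * (t + 1) / real n \<le> N * (t + 1) / real n"
    using AN n by (intro divide_right_mono mult_right_mono) (auto simp: t_def)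
  ultimately have "B \<ge> (1 - t * (t + 1) / (2 * real n)) * N - N * (t + 1) / real n"
    using IH by (meson diff_mono order_trans)
  also have "(1 - t * (t + 1) / (2 * real n)) * N - N * (t + 1) / real n
      = (1 - (t + 1) * (t + 2) / (2 * real n)) * N"
    using n by (simp add: field_simps)
  finally show ?case
    by (simp add: B_def N_def t_def algebra_simps)
qed

section \<open>Points in short cycles\<close>

definition periodic_points :: "nat \<Rightarrow> 'a set \<Rightarrow> ('a \<Rightarrow> 'a) \<Rightarrow> 'a set" where
  "periodic_points L S p = {x \<in> S. \<exists>k\<in>{1..L}. (p ^^ k) x = x}"

lemma funpow_conjugate:
  assumes "bij g"
  shows "(g \<circ> p \<circ> inv' g) ^^ k = g \<circ> p ^^ k \<circ> inv' g"
proof (induction k)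
  case 0
  then show ?case using assms by (auto simp: fun_eq_iff bij_is_surj surj_f_inv_f)
next
  case (Suc k)
  then show ?case using assms by (auto simp: fun_eq_iff bij_is_inj)
qed

text \<open>
  Conjugation relabels points; this is what allows words to be cyclically reduced and permutations to be
  brought into a normal form.
\<close>

lemma card_periodic_points_conjugate:
  assumes g: "g permutes S"
  shows "card (periodic_points L S (g \<circ> p \<circ> inv' g)) = card (periodic_points L S p)"
proof -
  note b = permutes_bij[OF g]
  have "periodic_points L S (g \<circ> p \<circ> inv' g) = g ` periodic_points L S p"
  proof (intro equalityI subsetI)
    fix x assume "x \<in> periodic_points L S (g \<circ> p \<circ> inv' g)"
    then obtain k where "x \<in> S" "k \<in> {1..L}" "g ((p ^^ k) (inv' g x)) = x"
      by (auto simp: periodic_points_def funpow_conjugate[OF b])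
    moreover from this have "(p ^^ k) (inv' g x) = inv' g x"
      using permutes_inverses(2)[OF g] by metis
    ultimately have "inv' g x \<in> periodic_points L S p"
      using permutes_in_image[OF permutes_inv[OF g], of x] unfolding periodic_points_def by blast
    then show "x \<in> g ` periodic_points L S p"
      using permutes_inverses(1)[OF g, of x] by (metis imageI)
  next
    fix x assume "x \<in> g ` periodic_points L S p"
    then obtain y k where "x = g y" "y \<in> S" "k \<in> {1..L}" "(p ^^ k) y = y"
      by (auto simp: periodic_points_def)
    then show "x \<in> periodic_points L S (g \<circ> p \<circ> inv' g)"
      unfolding periodic_points_def funpow_conjugate[OF b]
      using permutes_in_image[OF g, of y] permutes_inverses(2)[OF g, of y]
      by (intro CollectI conjI bexI[of _ k]) auto
  qed
  then show ?thesis
    using card_image[of g "periodic_points L S p"] b by (metis bij_is_inj inj_on_subset subset_UNIV)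
qed

lemma word_map_sym_group_append:
  assumes "\<sigma> \<in> substitutions n r" "fst ` set u \<subseteq> {1..r}" "fst ` set v \<subseteq> {1..r}"
  shows "word_map (sym_group n) (u @ v) \<sigma> = word_map (sym_group n) u \<sigma> \<circ> word_map (sym_group n) v \<sigma>"
  using assms(2)
proof (induction u)
  case (Cons a u)
  then show ?case by (simp add: word_map_sym_group_Cons[OF assms(1)] comp_assoc)
qed (simp add: word_map_sym_group_Nil)

lemma letters_power: "fst ` set (concat (replicate k u)) \<subseteq> fst ` set u"
  by (induction k) auto

lemma word_map_sym_group_power:
  assumes "\<sigma> \<in> substitutions n r" "fst ` set u \<subseteq> {1..r}"
  shows "word_map (sym_group n) (concat (replicate k u)) \<sigma> = word_map (sym_group n) u \<sigma> ^^ k"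
proof (induction k)
  case (Suc k)
  then show ?case
    using assms letters_power[of k u] by (simp add: word_map_sym_group_append[OF assms(1)])
qed (simp add: word_map_sym_group_Nil)

lemma reduced_power:
  assumes "reduced u" "u \<noteq> []" "hd u \<noteq> inv_letter (last u)"
  shows "reduced (concat (replicate k u))"
proof (induction k)
  case (Suc k)
  then show ?case
    using assms by (cases k) (auto simp: reduced_def successively_append_iff hd_append)
qed simp

text \<open>
  All the powers of \<open>u\<close> are treated by a single trajectory, that of the \<open>L\<close>-th power: a point
  fixed by the \<open>k\<close>-th power with \<open>k \<le> L\<close> is revisited after \<open>k\<close> rounds. A separate estimate for each \<open>k\<close>
  would lose a factor of \<open>L\<close>, and with it the exponent \<open>1 / 3\<close>.
\<close>

lemma not_distinct_trajectory_power:
  assumes \<sigma>: "\<sigma> \<in> substitutions n r" and u: "fst ` set u \<subseteq> {1..r}" "u \<noteq> []"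
    and x: "x \<in> periodic_points L S (word_map (sym_group n) u \<sigma>)"
  shows "\<not> distinct (trajectory \<sigma> (concat (replicate L u)) x)"
proof -
  obtain k where k: "1 \<le> k" "k \<le> L" "(word_map (sym_group n) u \<sigma> ^^ k) x = x"
    using x by (auto simp: periodic_points_def)
  define v where "v = concat (replicate k u)"
  have "hd (trajectory \<sigma> v x) = x"
    using k(3) letters_power[of k u] u
    by (simp add: v_def hd_trajectory[OF \<sigma>] word_map_sym_group_power[OF \<sigma>])
  moreover obtain a v' where "v = a # v'"
    using k(1) u(2) by (cases k; cases u) (auto simp: v_def)
  ultimately have "\<not> distinct (trajectory \<sigma> v x)"
    using last_in_set[OF trajectory_neq_Nil[of \<sigma> v' x]] by auto
  moreover have "concat (replicate L u) = concat (replicate (L - k) u) @ v"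
    using k(2) by (simp add: v_def flip: concat_append replicate_add)
  ultimately show ?thesis by (simp add: trajectory_append)
qed

lemma finite_periodic_points: "finite S \<Longrightarrow> finite (periodic_points L S p)"
  by (simp add: periodic_points_def)

text \<open>
  Divided by the number of substitutions, the left-hand side is the expected number of points in
  cycles of length at most \<open>L\<close>. Such a point has a trajectory of length \<open>T = L * length u\<close> that meets
  itself, which happens with probability at most \<open>T (T + 1) / (2 n)\<close>; there are \<open>n\<close> points. Cyclic
  reducedness is what makes the powers of \<open>u\<close> reduced words.
\<close>

lemma sum_periodic_points_cyclically_reduced:
  assumes red: "reduced u" and ne: "u \<noteq> []" and cyc: "hd u \<noteq> inv_letter (last u)"
    and ran: "fst ` set u \<subseteq> {1..r}" and L: "L \<ge> 1"
  shows "(\<Sum>\<sigma>\<in>substitutions n r. real (card (periodic_points L {1..n} (word_map (sym_group n) u \<sigma>))))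
           \<le> real (L * length u) ^ 2 * real (card (substitutions n r))"
proof -
  define T where "T = L * length u"
  define v where "v = concat (replicate L u)"
  define N where "N = real (card (substitutions n r))"
  have lv: "length v = T" by (simp add: v_def T_def length_concat sum_list_replicate)
  have vr: "fst ` set v \<subseteq> {1..r}" using letters_power[of L u] ran by (auto simp: v_def)
  have T: "T \<ge> 1" using L ne by (simp add: T_def Suc_le_eq)
  have bound: "real (card {\<sigma> \<in> substitutions n r. x \<in> periodic_points L {1..n} (word_map (sym_group n) u \<sigma>)})
      \<le> real (T * Suc T) / (2 * real n) * N" if x: "x \<in> {1..n}" for x
  proof -
    have "card {\<sigma> \<in> substitutions n r. x \<in> periodic_points L {1..n} (word_map (sym_group n) u \<sigma>)}
        \<le> card (substitutions n r - simple_substitutions n r v x)"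
      using not_distinct_trajectory_power[OF _ ran ne] finite_substitutions[of r n]
      by (intro card_mono finite_Diff) (auto simp: simple_substitutions_def v_def)
    also have "\<dots> = card (substitutions n r) - card (simple_substitutions n r v x)"
      using finite_subset[OF _ finite_substitutions[of r n]]
      by (intro card_Diff_subset) (auto simp: simple_substitutions_def)
    finally have "real (card {\<sigma> \<in> substitutions n r. x \<in> periodic_points L {1..n} (word_map (sym_group n) u \<sigma>)})
        \<le> real (card (substitutions n r) - card (simple_substitutions n r v x))" by simp
    also have "\<dots> = N - real (card (simple_substitutions n r v x))"
      unfolding N_def using card_mono[OF finite_substitutions[of r n], of "simple_substitutions n r v x"]
      by (subst of_nat_diff) (auto simp: simple_substitutions_def)
    also have "\<dots> \<le> N - (1 - real (T * Suc T) / (2 * real n)) * N"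
      using card_simple_substitutions_ge[OF reduced_power[OF red ne cyc, of L] _ x, of r] vr lv
      by (simp add: v_def N_def)
    finally show ?thesis by (simp add: left_diff_distrib)
  qed
  have card_eq: "card (periodic_points L {1..n} p) = (\<Sum>x\<in>{1..n}. if x \<in> periodic_points L {1..n} p then 1 else 0)"
    for p :: "nat \<Rightarrow> nat"
    by (subst sum.If_cases) (auto simp: periodic_points_def intro!: arg_cong[where f = card])
  have "(\<Sum>\<sigma>\<in>substitutions n r. real (card (periodic_points L {1..n} (word_map (sym_group n) u \<sigma>))))
      = (\<Sum>x\<in>{1..n}. \<Sum>\<sigma>\<in>substitutions n r.
            if x \<in> periodic_points L {1..n} (word_map (sym_group n) u \<sigma>) then 1 else 0)"
    unfolding card_eq of_nat_sum by (subst sum.swap) (intro sum.cong refl, auto)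
  also have "\<dots> = (\<Sum>x\<in>{1..n}. real (card {\<sigma> \<in> substitutions n r. x \<in> periodic_points L {1..n} (word_map (sym_group n) u \<sigma>)}))"
    using finite_substitutions[of r n]
    by (intro sum.cong refl) (subst sum.If_cases, auto simp: Int_def)
  also have "\<dots> \<le> (\<Sum>x\<in>{1..n}. real (T * Suc T) / (2 * real n) * N)"
    by (intro sum_mono bound)
  also have "\<dots> \<le> real (T * Suc T) / 2 * N"
    by (simp add: N_def)
  also have "\<dots> \<le> real T ^ 2 * N"
    using T by (intro mult_right_mono) (auto simp: power2_eq_square N_def simp flip: of_nat_mult)
  finally show ?thesis by (simp add: T_def N_def)
qed

text \<open>
  Stripping a first letter and a final letter inverse to it turns the value of the word into
  a conjugate, so the cycle type stays the same while the word becomes shorter. The stripped word is again non-empty because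
  a letter followed by its inverse is not reduced.
\<close>

lemma sum_periodic_points_reduced:
  assumes "reduced w" "w \<noteq> []" "fst ` set w \<subseteq> {1..r}" and L: "L \<ge> 1"
  shows "(\<Sum>\<sigma>\<in>substitutions n r. real (card (periodic_points L {1..n} (word_map (sym_group n) w \<sigma>))))
           \<le> real (L * length w) ^ 2 * real (card (substitutions n r))"
  using assms(1-3)
proof (induction w rule: length_induct)
  case (1 w)
  show ?case
  proof (cases "hd w = inv_letter (last w)")
    case False
    then show ?thesis using sum_periodic_points_cyclically_reduced 1 L by blast
  next
    case True
    define a where "a = hd w"
    have "length w \<noteq> 1" using True by (auto simp: length_Suc_conv inv_letter_def prod_eq_iff)
    then obtain v where w: "w = a # v @ [inv_letter a]"
      using 1(3) True by (cases w; cases "tl w" rule: rev_cases) (auto simp: a_def)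
    have v: "reduced v" "v \<noteq> []" "fst ` set v \<subseteq> {1..r}" and a: "fst a \<in> {1..r}"
      using 1(2,4) unfolding w by (auto simp: reduced_def successively_Cons successively_append_iff)
    have "word_map (sym_group n) w \<sigma> = act \<sigma> a \<circ> word_map (sym_group n) v \<sigma> \<circ> inv' (act \<sigma> a)"
      if \<sigma>: "\<sigma> \<in> substitutions n r" for \<sigma>
    proof -
      have "act \<sigma> (inv_letter a) = inv' (act \<sigma> a)"
        using permutes_bij[OF permutes_substitution[OF \<sigma> a]]
        by (auto simp: act_def inv_letter_def inv_inv_eq)
      then show ?thesis
        using v(3) a unfolding w
        by (simp add: word_map_sym_group_Cons[OF \<sigma>] word_map_sym_group_append[OF \<sigma>]
            word_map_sym_group_Nil comp_assoc)
    qed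
    then have "card (periodic_points L {1..n} (word_map (sym_group n) w \<sigma>))
        = card (periodic_points L {1..n} (word_map (sym_group n) v \<sigma>))"
      if "\<sigma> \<in> substitutions n r" for \<sigma>
      using card_periodic_points_conjugate[OF act_permutes[OF that a]] that by metis
    then have "(\<Sum>\<sigma>\<in>substitutions n r. real (card (periodic_points L {1..n} (word_map (sym_group n) w \<sigma>))))
        = (\<Sum>\<sigma>\<in>substitutions n r. real (card (periodic_points L {1..n} (word_map (sym_group n) v \<sigma>))))"
      by (intro sum.cong refl) simp
    also have "\<dots> \<le> real (L * length v) ^ 2 * real (card (substitutions n r))"
      using 1(1) v by (simp add: w)
    also have "\<dots> \<le> real (L * length w) ^ 2 * real (card (substitutions n r))"
      by (intro mult_right_mono power_mono) (auto simp: w)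
    finally show ?thesis .
  qed
qed

section \<open>A normal form for permutations with few cycles\<close>

text \<open>
  The positions at which a list fails to follow \<open>p\<close>. The last position always counts, so that
  the number of breaks is subadditive under concatenation.
\<close>

definition breaks :: "('a \<Rightarrow> 'a) \<Rightarrow> 'a list \<Rightarrow> nat set" where
  "breaks p xs = {i. i < length xs \<and> \<not> (Suc i < length xs \<and> p (xs ! i) = xs ! Suc i)}"

lemma finite_breaks: "finite (breaks p xs)"
  by (simp add: breaks_def)

lemma card_breaks_append: "card (breaks p (xs @ ys)) \<le> card (breaks p xs) + card (breaks p ys)"
proof -
  have "breaks p (xs @ ys) \<subseteq> breaks p xs \<union> (\<lambda>i. i + length xs) ` breaks p ys"
  proof
    fix i assume i: "i \<in> breaks p (xs @ ys)"
    show "i \<in> breaks p xs \<union> (\<lambda>i. i + length xs) ` breaks p ys"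
    proof (cases "i < length xs")
      case True
      then show ?thesis using i by (auto simp: breaks_def nth_append)
    next
      case False
      then have "i - length xs \<in> breaks p ys"
        using i by (auto simp: breaks_def nth_append Suc_diff_le)
      then show ?thesis using False by (intro UnI2 image_eqI[of _ _ "i - length xs"]) auto
    qed
  qed
  then have "card (breaks p (xs @ ys)) \<le> card (breaks p xs \<union> (\<lambda>i. i + length xs) ` breaks p ys)"
    by (intro card_mono) (auto simp: finite_breaks)
  also have "\<dots> \<le> card (breaks p xs) + card ((\<lambda>i. i + length xs) ` breaks p ys)"
    by (rule card_Un_le)
  also have "\<dots> \<le> card (breaks p xs) + card (breaks p ys)"
    by (simp add: card_image_le finite_breaks)
  finally show ?thesis .
qed

lemma breaks_cong: "(\<And>x. x \<in> set xs \<Longrightarrow> p x = q x) \<Longrightarrow> breaks p xs = breaks q xs"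
  by (auto simp: breaks_def)

lemma card_breaks_cycle:
  assumes "distinct cs"
  shows "card (breaks (cycle_of_list cs) cs) \<le> 1"
proof -
  have "map (cycle_of_list cs) cs = rotate1 cs"
    using cyclic_rotation[OF assms, of 1] by simp
  then have "cycle_of_list cs (cs ! i) = cs ! (Suc i mod length cs)" if "i < length cs" for i
    using that by (metis nth_map nth_rotate1)
  then have "breaks (cycle_of_list cs) cs \<subseteq> {length cs - 1}"
    by (auto simp: breaks_def)
  then show ?thesis
    using card_mono[of "{length cs - 1}"] by fastforce
qed

lemma funpow_eq_on:
  assumes "\<And>x. x \<in> A \<Longrightarrow> p x = q x" "\<And>x. x \<in> A \<Longrightarrow> q x \<in> A" "x \<in> A"
  shows "(p ^^ k) x = (q ^^ k) x"
proof -
  have "(p ^^ k) x = (q ^^ k) x \<and> (q ^^ k) x \<in> A"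
    using assms by (induction k) auto
  then show ?thesis ..
qed

lemma periodic_points_cong:
  assumes "\<And>x. x \<in> A \<Longrightarrow> p x = q x" "\<And>x. x \<in> A \<Longrightarrow> q x \<in> A"
  shows "periodic_points L A p = periodic_points L A q"
  using funpow_eq_on[of A p q] assms by (auto simp: periodic_points_def)

text \<open>
  Each cycle pays for its one break: a cycle of length at most \<open>L\<close> consists of periodic points, and a
  longer one has more than \<open>L\<close> points, each of which contributes \<open>1 / L\<close>.
\<close>

lemma one_le_cycle_weight:
  assumes "distinct cs" "cs \<noteq> []" "L \<ge> 1"
  shows "1 \<le> real (length cs) / real L + real (card (periodic_points L (set cs) (cycle_of_list cs)))"
proof (cases "length cs \<le> L")
  case True
  then have "periodic_points L (set cs) (cycle_of_list cs) = set cs"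
    using assms cycle_is_id_root[OF assms(1)]
    by (auto simp: periodic_points_def Suc_le_eq intro!: bexI[of _ "length cs"])
  then show ?thesis using assms by (simp add: distinct_card Suc_le_eq add_increasing)
qed (use assms in \<open>simp add: field_simps add_increasing2\<close>)

text \<open>
  Listing the cycles one after another gives one break per cycle. The bound thus estimates the number
  of cycles: at most \<open>card S / L\<close> of them are longer than \<open>L\<close>, and the others are at most as many as
  the points in them. That \<open>p\<close> permutes \<open>S\<close> is carried along because the induction needs \<open>S\<close> to be
  invariant.
\<close>

lemma exists_ordering_few_breaks:
  assumes "cycle_decomp S p" and L: "L \<ge> 1"
  shows "p permutes S \<and> (\<exists>xs. distinct xs \<and> set xs = S \<and>
           real (card (breaks p xs)) \<le> real (card S) / real L + real (card (periodic_points L S p)))"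
  using assms(1)
proof (induction rule: cycle_decomp.induct)
  case empty
  show ?case by (auto simp: breaks_def permutes_id)
next
  case (comp I p cs)
  define q where "q = cycle_of_list cs \<circ> p"
  from comp.IH obtain xs where p: "p permutes I" and xs: "distinct xs" "set xs = I"
    and le: "real (card (breaks p xs)) \<le> real (card I) / real L + real (card (periodic_points L I p))"
    by blast
  note cyc = cycle_permutes[of cs]
  have "q permutes set cs \<union> I"
    unfolding q_def using permutes_subset[OF p, of "set cs \<union> I"] permutes_subset[OF cyc, of "set cs \<union> I"]
    by (intro permutes_compose) auto
  moreover have "\<exists>ys. distinct ys \<and> set ys = set cs \<union> I \<and> real (card (breaks q ys))
      \<le> real (card (set cs \<union> I)) / real L + real (card (periodic_points L (set cs \<union> I) q))"
  proof (cases "cs = []")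
    case True
    then show ?thesis using xs le by (auto simp: q_def)
  next
    case False
    have qI: "q x = p x" if "x \<in> I" for x
      using that comp.hyps(3) permutes_in_image[OF p, of x] permutes_not_in[OF cyc, of "p x"]
      by (auto simp: q_def)
    have qcs: "q x = cycle_of_list cs x" if "x \<in> set cs" for x
      using that comp.hyps(3) permutes_not_in[OF p, of x] by (simp add: q_def disjoint_iff)
    have finI: "finite I" using xs(2) by auto
    have "real (card (breaks q (cs @ xs))) \<le> real (card (breaks q cs)) + real (card (breaks q xs))"
      using card_breaks_append[of q cs xs] by simp
    also have "breaks q cs = breaks (cycle_of_list cs) cs" using qcs by (intro breaks_cong)
    also have "breaks q xs = breaks p xs" using qI xs by (intro breaks_cong) auto
    also have "real (card (breaks (cycle_of_list cs) cs)) + real (card (breaks p xs))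
        \<le> (real (card (set cs)) / real L + real (card (periodic_points L (set cs) q)))
           + (real (card I) / real L + real (card (periodic_points L I q)))"
    proof (intro add_mono)
      have "periodic_points L (set cs) q = periodic_points L (set cs) (cycle_of_list cs)"
        using qcs permutes_in_image[OF cyc] by (intro periodic_points_cong) auto
      then show "real (card (breaks (cycle_of_list cs) cs))
          \<le> real (card (set cs)) / real L + real (card (periodic_points L (set cs) q))"
        using card_breaks_cycle[OF comp.hyps(2)] one_le_cycle_weight[OF comp.hyps(2) False L]
        by (simp add: distinct_card[OF comp.hyps(2)])
      have "periodic_points L I q = periodic_points L I p"
        using qI permutes_in_image[OF p] by (intro periodic_points_cong) auto
      then show "real (card (breaks p xs)) \<le> real (card I) / real L + real (card (periodic_points L I q))"
        using le by simp
    qed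
    also have "\<dots> = real (card (set cs) + card I) / real L
        + real (card (periodic_points L (set cs) q) + card (periodic_points L I q))"
      by (simp add: add_divide_distrib)
    also have "card (set cs) + card I = card (set cs \<union> I)"
      using comp.hyps(3) finI by (simp add: card_Un_disjoint)
    also have "card (periodic_points L (set cs) q) + card (periodic_points L I q)
        = card (periodic_points L (set cs) q \<union> periodic_points L I q)"
      using comp.hyps(3) finI
      by (subst card_Un_disjoint) (auto simp: finite_periodic_points, auto simp: periodic_points_def)
    also have "periodic_points L (set cs) q \<union> periodic_points L I q = periodic_points L (set cs \<union> I) q"
      by (auto simp: periodic_points_def)
    finally show ?thesis
      using xs comp.hyps by (intro exI[of _ "cs @ xs"]) auto
  qed
  ultimately show ?case unfolding q_def by blast
qed

text \<open>
  The ordering of the previous lemma, read as a relabelling of the points, makes \<open>p\<close> agree with \<open>Suc\<close> away from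
  the breaks. Comparison with \<open>Suc\<close>, which is not a permutation of \<open>{1..n}\<close>, is as good as with the
  \<open>n\<close>-cycle \<open>(1 2 \<dots> n)\<close>: they differ only at \<open>n\<close>, which counts as a break in any case.
\<close>

lemma exists_conjugate_near_successor:
  assumes p: "p permutes {1..n}" and L: "L \<ge> 1"
  shows "\<exists>\<alpha>. \<alpha> permutes {1..n} \<and> real (card {i \<in> {1..n}. (inv' \<alpha> \<circ> p \<circ> \<alpha>) i \<noteq> Suc i})
           \<le> real n / real L + real (card (periodic_points L {1..n} p))"
proof -
  obtain xs where xs: "distinct xs" "set xs = {1..n}"
    and le: "real (card (breaks p xs)) \<le> real n / real L + real (card (periodic_points L {1..n} p))"
    using exists_ordering_few_breaks[OF cycle_decomposition[OF p] L] by auto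
  have len: "length xs = n" using distinct_card[OF xs(1)] xs(2) by simp
  define \<alpha> where "\<alpha> i = (if i \<in> {1..n} then xs ! (i - 1) else i)" for i
  have "bij_betw (\<lambda>i. xs ! (i - 1)) {1..n} {1..n}"
  proof -
    have "bij_betw (\<lambda>i. i - 1) {1..n} {..<n}"
      by (rule bij_betw_byWitness[where f' = Suc]) auto
    moreover have "bij_betw ((!) xs) {..<n} {1..n}"
      using bij_betw_nth[OF xs(1), of "{..<n}" "{1..n}"] len xs(2) by simp
    ultimately show ?thesis
      using bij_betw_trans by (fastforce simp: comp_def)
  qed
  then have "bij_betw \<alpha> {1..n} {1..n}"
    by (subst bij_betw_cong[where g = "\<lambda>i. xs ! (i - 1)"]) (auto simp: \<alpha>_def)
  then have \<alpha>: "\<alpha> permutes {1..n}"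
    by (rule bij_imp_permutes) (auto simp: \<alpha>_def)
  have "{i \<in> {1..n}. (inv' \<alpha> \<circ> p \<circ> \<alpha>) i \<noteq> Suc i} \<subseteq> Suc ` breaks p xs"
  proof
    fix i assume i: "i \<in> {i \<in> {1..n}. (inv' \<alpha> \<circ> p \<circ> \<alpha>) i \<noteq> Suc i}"
    have "i - 1 \<in> breaks p xs"
    proof (rule ccontr)
      assume "i - 1 \<notin> breaks p xs"
      then have "i < n" "p (xs ! (i - 1)) = xs ! i"
        using i len by (auto simp: breaks_def)
      then have "p (\<alpha> i) = \<alpha> (Suc i)" using i by (simp add: \<alpha>_def)
      then show False
        using i permutes_inverses(2)[OF \<alpha>, of "Suc i"] by simp
    qed
    then show "i \<in> Suc ` breaks p xs"
      using i by (intro image_eqI[of _ _ "i - 1"]) auto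
  qed
  then have "card {i \<in> {1..n}. (inv' \<alpha> \<circ> p \<circ> \<alpha>) i \<noteq> Suc i} \<le> card (breaks p xs)"
    by (rule surj_card_le[OF finite_breaks])
  then show ?thesis using \<alpha> le by (intro exI[of _ \<alpha>]) linarith
qed

section \<open>Coupling conjugation-invariant measures\<close>

lemma hamming_dist_conjugate:
  assumes \<pi>: "\<pi> permutes {1..n}"
  shows "hamming_dist n (\<pi> \<circ> p \<circ> inv' \<pi>) (\<pi> \<circ> q \<circ> inv' \<pi>) = hamming_dist n p q"
proof -
  have inj: "\<pi> x = \<pi> y \<longleftrightarrow> x = y" for x y
    using permutes_inj[OF \<pi>] by (auto dest: injD)
  have "{i \<in> {1..n}. (\<pi> \<circ> p \<circ> inv' \<pi>) i \<noteq> (\<pi> \<circ> q \<circ> inv' \<pi>) i} = \<pi> ` {i \<in> {1..n}. p i \<noteq> q i}"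
  proof (intro equalityI subsetI)
    fix i assume i: "i \<in> {i \<in> {1..n}. (\<pi> \<circ> p \<circ> inv' \<pi>) i \<noteq> (\<pi> \<circ> q \<circ> inv' \<pi>) i}"
    then have "inv' \<pi> i \<in> {i \<in> {1..n}. p i \<noteq> q i}"
      using permutes_in_image[OF permutes_inv[OF \<pi>], of i] by (auto simp: inj)
    then show "i \<in> \<pi> ` {i \<in> {1..n}. p i \<noteq> q i}"
      using permutes_inverses(1)[OF \<pi>, of i] by (metis imageI)
  next
    fix i assume "i \<in> \<pi> ` {i \<in> {1..n}. p i \<noteq> q i}"
    then obtain j where "i = \<pi> j" "j \<in> {1..n}" "p j \<noteq> q j" by auto
    then show "i \<in> {i \<in> {1..n}. (\<pi> \<circ> p \<circ> inv' \<pi>) i \<noteq> (\<pi> \<circ> q \<circ> inv' \<pi>) i}"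
      using permutes_in_image[OF \<pi>, of j] permutes_inverses(2)[OF \<pi>, of j] by (simp add: inj)
  qed
  moreover have "card (\<pi> ` {i \<in> {1..n}. p i \<noteq> q i}) = card {i \<in> {1..n}. p i \<noteq> q i}"
    using permutes_inj[OF \<pi>] by (intro card_image) (auto intro: inj_on_subset)
  ultimately show ?thesis by (simp add: hamming_dist_def)
qed

lemma hamming_dist_le_via:
  "hamming_dist n p q
     \<le> (real (card {i \<in> {1..n}. p i \<noteq> c i}) + real (card {i \<in> {1..n}. q i \<noteq> c i})) / real n"
proof -
  have "card {i \<in> {1..n}. p i \<noteq> q i}
      \<le> card ({i \<in> {1..n}. p i \<noteq> c i} \<union> {i \<in> {1..n}. q i \<noteq> c i})"
    by (intro card_mono) auto
  also have "\<dots> \<le> card {i \<in> {1..n}. p i \<noteq> c i} + card {i \<in> {1..n}. q i \<noteq> c i}"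
    by (rule card_Un_le)
  finally show ?thesis
    unfolding hamming_dist_def by (intro divide_right_mono) linarith+
qed

definition conjugation_invariant :: "nat \<Rightarrow> (nat \<Rightarrow> nat) pmf \<Rightarrow> bool" where
  "conjugation_invariant n \<mu> \<longleftrightarrow>
     set_pmf \<mu> \<subseteq> carrier (sym_group n) \<and>
     (\<forall>\<pi>. \<pi> permutes {1..n} \<longrightarrow> map_pmf (\<lambda>p. \<pi> \<circ> p \<circ> inv' \<pi>) \<mu> = \<mu>)"

lemma finite_sym_group: "finite (carrier (sym_group n))"
  by (simp add: sym_group_def finite_permutations)

lemma sym_group_nonempty: "carrier (sym_group n) \<noteq> {}"
  using monoid.one_closed[OF group.is_monoid[OF sym_group_is_group[of n]]] by blast

text \<open>
  Replacing each permutation by some representative of its conjugacy class and then conjugating by a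
  uniformly random permutation reproduces a conjugation-invariant measure: for fixed \<open>p\<close>, the
  conjugator that defines the representative is absorbed into the random one, since the uniform measure
  is invariant under translation.
\<close>

lemma map_pmf_random_conjugate:
  assumes inv: "conjugation_invariant n \<mu>"
    and \<alpha>: "\<And>p. p permutes {1..n} \<Longrightarrow> \<alpha> p permutes {1..n}"
  shows "map_pmf (\<lambda>(\<pi>, p). \<pi> \<circ> (inv' (\<alpha> p) \<circ> p \<circ> \<alpha> p) \<circ> inv' \<pi>) (pair_pmf (unif_measure n) \<mu>) = \<mu>"
proof -
  have shift: "map_pmf (\<lambda>\<pi>. \<pi> \<circ> (inv' (\<alpha> p) \<circ> p \<circ> \<alpha> p) \<circ> inv' \<pi>) (unif_measure n)
      = map_pmf (\<lambda>\<rho>. \<rho> \<circ> p \<circ> inv' \<rho>) (unif_measure n)" if "p \<in> set_pmf \<mu>" for p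
  proof -
    have a: "\<alpha> p permutes {1..n}"
      using \<alpha> that inv by (auto simp: conjugation_invariant_def sym_group_carrier)
    have "bij_betw (\<lambda>\<pi>. \<pi> \<circ> inv' (\<alpha> p)) (carrier (sym_group n)) (carrier (sym_group n))"
      using a
      by (intro bij_betwI[where g = "\<lambda>\<pi>. \<pi> \<circ> \<alpha> p"])
        (auto simp: sym_group_def permutes_inv permutes_inv_o comp_assoc intro!: permutes_compose)
    then have "unif_measure n = map_pmf (\<lambda>\<pi>. \<pi> \<circ> inv' (\<alpha> p)) (unif_measure n)"
      unfolding unif_measure_def
      by (subst map_pmf_of_set_bij_betw) (auto simp: finite_sym_group sym_group_nonempty)
    then have "map_pmf (\<lambda>\<rho>. \<rho> \<circ> p \<circ> inv' \<rho>) (unif_measure n)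
        = map_pmf (\<lambda>\<pi>. (\<pi> \<circ> inv' (\<alpha> p)) \<circ> p \<circ> inv' (\<pi> \<circ> inv' (\<alpha> p))) (unif_measure n)"
      by (metis (no_types, lifting) map_pmf_comp map_pmf_cong)
    also have "\<dots> = map_pmf (\<lambda>\<pi>. \<pi> \<circ> (inv' (\<alpha> p) \<circ> p \<circ> \<alpha> p) \<circ> inv' \<pi>) (unif_measure n)"
    proof (rule map_pmf_cong[OF refl])
      fix \<pi> assume "\<pi> \<in> set_pmf (unif_measure n)"
      then have "\<pi> permutes {1..n}"
        by (simp add: unif_measure_def finite_sym_group sym_group_nonempty sym_group_carrier)
      then have "inv' (\<pi> \<circ> inv' (\<alpha> p)) = \<alpha> p \<circ> inv' \<pi>"
        using permutes_bij[OF a]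
        by (simp add: o_inv_distrib[OF permutes_bij] bij_imp_bij_inv inv_inv_eq)
      then show "(\<pi> \<circ> inv' (\<alpha> p)) \<circ> p \<circ> inv' (\<pi> \<circ> inv' (\<alpha> p))
          = \<pi> \<circ> (inv' (\<alpha> p) \<circ> p \<circ> \<alpha> p) \<circ> inv' \<pi>"
        by (simp add: comp_assoc)
    qed
    finally show ?thesis ..
  qed
  have "map_pmf (\<lambda>(\<pi>, p). \<pi> \<circ> (inv' (\<alpha> p) \<circ> p \<circ> \<alpha> p) \<circ> inv' \<pi>) (pair_pmf (unif_measure n) \<mu>)
      = bind_pmf (unif_measure n) (\<lambda>\<pi>. bind_pmf \<mu> (\<lambda>p. return_pmf (\<pi> \<circ> (inv' (\<alpha> p) \<circ> p \<circ> \<alpha> p) \<circ> inv' \<pi>)))"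
    by (simp add: pair_pmf_def map_bind_pmf)
  also have "\<dots> = bind_pmf \<mu> (\<lambda>p. map_pmf (\<lambda>\<pi>. \<pi> \<circ> (inv' (\<alpha> p) \<circ> p \<circ> \<alpha> p) \<circ> inv' \<pi>) (unif_measure n))"
    by (subst bind_commute_pmf) (simp add: map_pmf_def)
  also have "\<dots> = bind_pmf \<mu> (\<lambda>p. map_pmf (\<lambda>\<rho>. \<rho> \<circ> p \<circ> inv' \<rho>) (unif_measure n))"
    using shift by (intro bind_pmf_cong refl)
  also have "\<dots> = bind_pmf (unif_measure n) (\<lambda>\<rho>. map_pmf (\<lambda>p. \<rho> \<circ> p \<circ> inv' \<rho>) \<mu>)"
    unfolding map_pmf_def by (rule bind_commute_pmf)
  also have "\<dots> = bind_pmf (unif_measure n) (\<lambda>_. \<mu>)"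
    using inv
    by (intro bind_pmf_cong refl)
      (simp add: conjugation_invariant_def unif_measure_def finite_sym_group sym_group_nonempty sym_group_carrier)
  finally show ?thesis by simp
qed

text \<open>
  The coupling: draw \<open>p\<close> from \<open>\<mu>\<close> and \<open>q\<close> from \<open>\<nu>\<close> independently, bring both into the normal form
  close to \<open>Suc\<close>, and conjugate the two normal forms by the same uniformly random permutation. The
  simultaneous conjugation restores the marginals without changing the Hamming distance, which is at
  most the sum of the distances of both normal forms to \<open>Suc\<close>.
\<close>

lemma KR_dist_conjugation_invariant_le:
  assumes \<mu>: "conjugation_invariant n \<mu>" and \<nu>: "conjugation_invariant n \<nu>"
    and n: "n \<ge> 1" and L: "L \<ge> 1"
  shows "KR_dist (carrier (sym_group n)) (hamming_dist n) \<mu> \<nu>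
    \<le> 2 / real L
       + measure_pmf.expectation \<mu> (\<lambda>p. real (card (periodic_points L {1..n} p))) / real n
       + measure_pmf.expectation \<nu> (\<lambda>p. real (card (periodic_points L {1..n} p))) / real n"
proof -
  define weight where "weight p = 1 / real L + real (card (periodic_points L {1..n} p)) / real n"
    for p :: "nat \<Rightarrow> nat"
  have "\<forall>p. \<exists>\<beta>. p permutes {1..n} \<longrightarrow> \<beta> permutes {1..n} \<and>
      real (card {i \<in> {1..n}. (inv' \<beta> \<circ> p \<circ> \<beta>) i \<noteq> Suc i})
        \<le> real n / real L + real (card (periodic_points L {1..n} p))"
    using exists_conjugate_near_successor[OF _ L, of _ n] by blast
  from choice[OF this] obtain \<alpha> where all: "\<forall>p. p permutes {1..n} \<longrightarrow> \<alpha> p permutes {1..n} \<and>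
      real (card {i \<in> {1..n}. (inv' (\<alpha> p) \<circ> p \<circ> \<alpha> p) i \<noteq> Suc i})
        \<le> real n / real L + real (card (periodic_points L {1..n} p))" ..
  then have \<alpha>: "\<And>p. p permutes {1..n} \<Longrightarrow> \<alpha> p permutes {1..n}"
    and near: "\<And>p. p permutes {1..n} \<Longrightarrow>
        real (card {i \<in> {1..n}. (inv' (\<alpha> p) \<circ> p \<circ> \<alpha> p) i \<noteq> Suc i})
          \<le> real n / real L + real (card (periodic_points L {1..n} p))"
    by blast+
  define normal where "normal p = inv' (\<alpha> p) \<circ> p \<circ> \<alpha> p" for p
  define \<gamma> where "\<gamma> = map_pmf (\<lambda>(\<pi>, p, q). (\<pi> \<circ> normal p \<circ> inv' \<pi>, \<pi> \<circ> normal q \<circ> inv' \<pi>))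
      (pair_pmf (unif_measure n) (pair_pmf \<mu> \<nu>))"
  have perm: "p permutes {1..n}" if "p \<in> set_pmf \<mu> \<or> p \<in> set_pmf \<nu>" for p
    using that \<mu> \<nu> by (auto simp: conjugation_invariant_def sym_group_carrier)
  have set_unif: "set_pmf (unif_measure n) = {\<pi>. \<pi> permutes {1..n}}"
    by (simp add: unif_measure_def finite_sym_group sym_group_nonempty) (simp add: sym_group_def)
  have fin: "finite (set_pmf \<mu>)" "finite (set_pmf \<nu>)" "finite (set_pmf (unif_measure n))"
    using \<mu> \<nu> finite_subset[OF _ finite_sym_group[of n]]
    by (auto simp: conjugation_invariant_def unif_measure_def finite_sym_group sym_group_nonempty)
  have "map_pmf fst \<gamma> = map_pmf (\<lambda>(\<pi>, p). \<pi> \<circ> normal p \<circ> inv' \<pi>) (map_pmf (\<lambda>(\<pi>, p, q). (\<pi>, p))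
      (pair_pmf (unif_measure n) (pair_pmf \<mu> \<nu>)))"
    by (simp add: \<gamma>_def map_pmf_comp case_prod_unfold)
  also have "map_pmf (\<lambda>(\<pi>, p, q). (\<pi>, p)) (pair_pmf (unif_measure n) (pair_pmf \<mu> \<nu>)) = pair_pmf (unif_measure n) \<mu>"
    using map_pair[of id fst "unif_measure n" "pair_pmf \<mu> \<nu>"] by (simp add: map_fst_pair_pmf case_prod_unfold)
  also have "map_pmf (\<lambda>(\<pi>, p). \<pi> \<circ> normal p \<circ> inv' \<pi>) \<dots> = \<mu>"
    unfolding normal_def using \<mu> \<alpha> by (rule map_pmf_random_conjugate)
  finally have fst: "map_pmf fst \<gamma> = \<mu>" .
  have "map_pmf snd \<gamma> = map_pmf (\<lambda>(\<pi>, p). \<pi> \<circ> normal p \<circ> inv' \<pi>) (map_pmf (\<lambda>(\<pi>, p, q). (\<pi>, q))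
      (pair_pmf (unif_measure n) (pair_pmf \<mu> \<nu>)))"
    by (simp add: \<gamma>_def map_pmf_comp case_prod_unfold)
  also have "map_pmf (\<lambda>(\<pi>, p, q). (\<pi>, q)) (pair_pmf (unif_measure n) (pair_pmf \<mu> \<nu>)) = pair_pmf (unif_measure n) \<nu>"
    using map_pair[of id snd "unif_measure n" "pair_pmf \<mu> \<nu>"] by (simp add: map_snd_pair_pmf case_prod_unfold)
  also have "map_pmf (\<lambda>(\<pi>, p). \<pi> \<circ> normal p \<circ> inv' \<pi>) \<dots> = \<nu>"
    unfolding normal_def using \<nu> \<alpha> by (rule map_pmf_random_conjugate)
  finally have snd: "map_pmf snd \<gamma> = \<nu>" .
  have "set_pmf \<gamma> \<subseteq> set_pmf (map_pmf fst \<gamma>) \<times> set_pmf (map_pmf snd \<gamma>)"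
    by force
  then have supp: "set_pmf \<gamma> \<subseteq> carrier (sym_group n) \<times> carrier (sym_group n)"
    using \<mu> \<nu> unfolding fst snd conjugation_invariant_def by blast
  have "KR_dist (carrier (sym_group n)) (hamming_dist n) \<mu> \<nu>
      \<le> measure_pmf.expectation \<gamma> (\<lambda>(p, q). hamming_dist n p q)"
    unfolding KR_dist_def
  proof (rule cInf_lower)
    show "bdd_below {measure_pmf.expectation \<gamma> (\<lambda>(\<sigma>, \<tau>). hamming_dist n \<sigma> \<tau>) |\<gamma>.
        set_pmf \<gamma> \<subseteq> carrier (sym_group n) \<times> carrier (sym_group n) \<and> map_pmf fst \<gamma> = \<mu> \<and> map_pmf snd \<gamma> = \<nu>}"
      by (rule bdd_belowI[of _ 0]) (auto intro!: integral_nonneg simp: hamming_dist_def case_prod_unfold)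
  qed (use supp fst snd in blast)
  also have "\<dots> = measure_pmf.expectation (pair_pmf (unif_measure n) (pair_pmf \<mu> \<nu>))
      (\<lambda>(\<pi>, p, q). hamming_dist n (\<pi> \<circ> normal p \<circ> inv' \<pi>) (\<pi> \<circ> normal q \<circ> inv' \<pi>))"
    by (simp add: \<gamma>_def case_prod_unfold)
  also have "\<dots> \<le> measure_pmf.expectation (pair_pmf (unif_measure n) (pair_pmf \<mu> \<nu>))
      (\<lambda>e. weight (fst (snd e)) + weight (snd (snd e)))"
  proof (rule integral_mono_AE)
    show "AE e in measure_pmf (pair_pmf (unif_measure n) (pair_pmf \<mu> \<nu>)).
        (case e of (\<pi>, p, q) \<Rightarrow> hamming_dist n (\<pi> \<circ> normal p \<circ> inv' \<pi>) (\<pi> \<circ> normal q \<circ> inv' \<pi>))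
          \<le> weight (fst (snd e)) + weight (snd (snd e))"
    proof (rule AE_pmfI, clarsimp)
      fix \<pi> p q assume *: "\<pi> \<in> set_pmf (unif_measure n)" "p \<in> set_pmf \<mu>" "q \<in> set_pmf \<nu>"
      have "hamming_dist n (\<pi> \<circ> normal p \<circ> inv' \<pi>) (\<pi> \<circ> normal q \<circ> inv' \<pi>)
          = hamming_dist n (normal p) (normal q)"
        using * set_unif by (intro hamming_dist_conjugate) auto
      also have "\<dots> \<le> (real (card {i \<in> {1..n}. normal p i \<noteq> Suc i})
          + real (card {i \<in> {1..n}. normal q i \<noteq> Suc i})) / real n"
        by (rule hamming_dist_le_via)
      also have "\<dots> \<le> ((real n / real L + real (card (periodic_points L {1..n} p)))
          + (real n / real L + real (card (periodic_points L {1..n} q)))) / real n"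
        unfolding normal_def using * perm by (intro divide_right_mono add_mono near) auto
      also have "\<dots> = weight p + weight q"
        using n L by (simp add: weight_def field_simps)
      finally show "hamming_dist n (\<pi> \<circ> normal p \<circ> inv' \<pi>) (\<pi> \<circ> normal q \<circ> inv' \<pi>) \<le> weight p + weight q" .
    qed
  qed (auto intro!: integrable_measure_pmf_finite simp: fin)
  also have "\<dots> = measure_pmf.expectation (pair_pmf \<mu> \<nu>) (\<lambda>e. weight (fst e) + weight (snd e))"
    using expectation_pair_pmf_snd[of "unif_measure n" "pair_pmf \<mu> \<nu>" "\<lambda>e. weight (fst e) + weight (snd e)"] .
  also have "\<dots> = measure_pmf.expectation \<mu> weight + measure_pmf.expectation \<nu> weight"
    by (subst Bochner_Integration.integral_add)
      (auto intro!: integrable_measure_pmf_finite simp: fin)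
  also have "measure_pmf.expectation \<mu> weight
      = 1 / real L + measure_pmf.expectation \<mu> (\<lambda>p. real (card (periodic_points L {1..n} p))) / real n"
    unfolding weight_def
    by (subst Bochner_Integration.integral_add) (auto intro!: integrable_measure_pmf_finite simp: fin)
  also have "measure_pmf.expectation \<nu> weight
      = 1 / real L + measure_pmf.expectation \<nu> (\<lambda>p. real (card (periodic_points L {1..n} p))) / real n"
    unfolding weight_def
    by (subst Bochner_Integration.integral_add) (auto intro!: integrable_measure_pmf_finite simp: fin)
  finally show ?thesis by simp
qed

section \<open>Word measures\<close>

definition conjugate_substitution :: "nat \<Rightarrow> (nat \<Rightarrow> nat) \<Rightarrow> (nat \<Rightarrow> nat \<Rightarrow> nat) \<Rightarrow> (nat \<Rightarrow> nat \<Rightarrow> nat)" where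
  "conjugate_substitution r \<pi> \<sigma> = (\<lambda>i\<in>{1..r}. \<pi> \<circ> \<sigma> i \<circ> inv' \<pi>)"

lemma conjugate_substitution_in:
  assumes "\<sigma> \<in> substitutions n r" "\<pi> permutes {1..n}"
  shows "conjugate_substitution r \<pi> \<sigma> \<in> substitutions n r"
proof (rule PiE_I)
  fix i assume "i \<in> {1..r}"
  then show "conjugate_substitution r \<pi> \<sigma> i \<in> carrier (sym_group n)"
    using permutes_substitution[OF assms(1), of i] assms(2)
    by (auto simp: conjugate_substitution_def sym_group_carrier intro!: permutes_compose permutes_inv)
qed (auto simp: conjugate_substitution_def)

lemma conjugate_substitution_inverse:
  assumes "\<sigma> \<in> substitutions n r" "\<pi> permutes {1..n}"
  shows "conjugate_substitution r (inv' \<pi>) (conjugate_substitution r \<pi> \<sigma>) = \<sigma>"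
proof (rule ext)
  fix i
  show "conjugate_substitution r (inv' \<pi>) (conjugate_substitution r \<pi> \<sigma>) i = \<sigma> i"
  proof (cases "i \<in> {1..r}")
    case True
    then show ?thesis
      using permutes_inverses[OF assms(2)]
      by (auto simp: conjugate_substitution_def fun_eq_iff inv_inv_eq[OF permutes_bij[OF assms(2)]])
  next
    case False
    then show ?thesis
      using assms(1) by (auto simp: conjugate_substitution_def PiE_iff extensional_def)
  qed
qed

lemma bij_betw_conjugate_substitution:
  assumes \<pi>: "\<pi> permutes {1..n}"
  shows "bij_betw (conjugate_substitution r \<pi>) (substitutions n r) (substitutions n r)"
  using conjugate_substitution_in[OF _ \<pi>] conjugate_substitution_in[OF _ permutes_inv[OF \<pi>]]
    conjugate_substitution_inverse[OF _ \<pi>] conjugate_substitution_inverse[OF _ permutes_inv[OF \<pi>]]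
  by (intro bij_betwI[where g = "conjugate_substitution r (inv' \<pi>)"])
    (auto simp: inv_inv_eq[OF permutes_bij[OF \<pi>]])

lemma act_conjugate_substitution:
  assumes \<sigma>: "\<sigma> \<in> substitutions n r" and \<pi>: "\<pi> permutes {1..n}" and a: "fst a \<in> {1..r}"
  shows "act (conjugate_substitution r \<pi> \<sigma>) a = \<pi> \<circ> act \<sigma> a \<circ> inv' \<pi>"
proof (cases "snd a")
  case False
  have "inv' (\<pi> \<circ> \<sigma> (fst a) \<circ> inv' \<pi>) = \<pi> \<circ> inv' (\<sigma> (fst a)) \<circ> inv' \<pi>"
    using permutes_bij[OF permutes_substitution[OF \<sigma> a]] permutes_bij[OF \<pi>]
    by (simp add: o_inv_distrib bij_comp bij_imp_bij_inv inv_inv_eq comp_assoc)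
  then show ?thesis using False a by (simp add: act_def conjugate_substitution_def)
qed (use a in \<open>simp add: act_def conjugate_substitution_def\<close>)

text \<open>
  Word maps commute with automorphisms, in particular with simultaneous conjugation; this makes
  word measures invariant under conjugation.
\<close>

lemma word_map_conjugate_substitution:
  assumes \<sigma>: "\<sigma> \<in> substitutions n r" and \<pi>: "\<pi> permutes {1..n}" and w: "fst ` set w \<subseteq> {1..r}"
  shows "word_map (sym_group n) w (conjugate_substitution r \<pi> \<sigma>)
           = \<pi> \<circ> word_map (sym_group n) w \<sigma> \<circ> inv' \<pi>"
  using w
proof (induction w)
  case Nil
  then show ?case by (simp add: word_map_sym_group_Nil permutes_inv_o[OF \<pi>])
next
  case (Cons a w)
  then show ?case
    using permutes_inverses(2)[OF \<pi>]
    by (simp add: word_map_sym_group_Cons[OF \<sigma>] act_conjugate_substitution[OF \<sigma> \<pi>]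
        word_map_sym_group_Cons[OF conjugate_substitution_in[OF \<sigma> \<pi>]] fun_eq_iff)
qed

lemma set_pmf_substitutions: "set_pmf (pmf_of_set (substitutions n r)) = substitutions n r"
  by (rule set_pmf_of_set[OF substitutions_nonempty finite_substitutions])

lemma conjugation_invariant_word_measure:
  assumes w: "fst ` set w \<subseteq> {1..r}"
  shows "conjugation_invariant n (word_measure n r w)"
  unfolding conjugation_invariant_def
proof (intro conjI allI impI)
  show "set_pmf (word_measure n r w) \<subseteq> carrier (sym_group n)"
    unfolding word_measure_def set_map_pmf set_pmf_substitutions
    using word_map_permutes[OF _ w] by (auto simp: sym_group_carrier)
next
  fix \<pi> assume \<pi>: "\<pi> permutes {1..n}"
  have "map_pmf (\<lambda>p. \<pi> \<circ> p \<circ> inv' \<pi>) (word_measure n r w)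
      = map_pmf (word_map (sym_group n) w) (map_pmf (conjugate_substitution r \<pi>) (pmf_of_set (substitutions n r)))"
    unfolding word_measure_def map_pmf_comp
    by (intro map_pmf_cong refl, subst (asm) set_pmf_substitutions)
      (simp only: word_map_conjugate_substitution[OF _ \<pi> w])
  also have "\<dots> = word_measure n r w"
    unfolding word_measure_def
    by (subst map_pmf_of_set_bij_betw[OF bij_betw_conjugate_substitution[OF \<pi>] substitutions_nonempty finite_substitutions]) simp
  finally show "map_pmf (\<lambda>p. \<pi> \<circ> p \<circ> inv' \<pi>) (word_measure n r w) = word_measure n r w" .
qed

text \<open>
  Hence the estimate for word measures applies to the uniform measure as well.
\<close>

lemma unif_measure_eq_word_measure: "unif_measure n = word_measure n 1 [(1, True)]"
proof -
  have "bij_betw (\<lambda>\<sigma>. \<sigma> 1) (substitutions n 1) (carrier (sym_group n))"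
  proof (rule bij_betwI[where g = "\<lambda>p. \<lambda>i\<in>{1..1}. p"])
    fix \<sigma> assume "\<sigma> \<in> substitutions n 1"
    then show "(\<lambda>i\<in>{1..1}. \<sigma> 1) = \<sigma>"
      by (intro ext) (auto simp: PiE_iff extensional_def)
  qed auto
  then have "unif_measure n = map_pmf (\<lambda>\<sigma>. \<sigma> 1) (pmf_of_set (substitutions n 1))"
    unfolding unif_measure_def
    by (intro map_pmf_of_set_bij_betw[symmetric] substitutions_nonempty finite_substitutions)
  also have "\<dots> = word_measure n 1 [(1, True)]"
    unfolding word_measure_def
  proof (intro map_pmf_cong refl)
    fix \<sigma> assume "\<sigma> \<in> set_pmf (pmf_of_set (substitutions n 1))"
    then have "\<sigma> 1 \<in> carrier (sym_group n)"
      unfolding set_pmf_substitutions by (auto simp: PiE_iff)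
    then show "\<sigma> 1 = word_map (sym_group n) [(1, True)] \<sigma>"
      by (rule group.word_map_generator[OF sym_group_is_group, symmetric])
  qed
  finally show ?thesis .
qed

lemma expectation_periodic_points_word_measure:
  assumes "reduced w" "w \<noteq> []" "fst ` set w \<subseteq> {1..r}" "L \<ge> 1"
  shows "measure_pmf.expectation (word_measure n r w) (\<lambda>p. real (card (periodic_points L {1..n} p)))
           \<le> real (L * length w) ^ 2"
proof -
  have "card (substitutions n r) > 0"
    by (rule card_gt_0_iff[THEN iffD2, OF conjI[OF substitutions_nonempty finite_substitutions]])
  then show ?thesis
    using sum_periodic_points_reduced[OF assms, of n]
    unfolding word_measure_def integral_map_pmf
    by (subst integral_pmf_of_set[OF substitutions_nonempty finite_substitutions])
      (simp add: pos_divide_le_eq)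
qed

lemma KR_dist_word_measure_le:
  assumes w: "reduced w" "w \<noteq> []" "fst ` set w \<subseteq> {1..r}" and n: "n \<ge> 1" and L: "L \<ge> 1"
  shows "KR_dist (carrier (sym_group n)) (hamming_dist n) (word_measure n r w) (unif_measure n)
           \<le> 2 / real L + 2 * real (L * length w) ^ 2 / real n"
proof -
  have "KR_dist (carrier (sym_group n)) (hamming_dist n) (word_measure n r w) (unif_measure n)
    \<le> 2 / real L
       + measure_pmf.expectation (word_measure n r w) (\<lambda>p. real (card (periodic_points L {1..n} p))) / real n
       + measure_pmf.expectation (unif_measure n) (\<lambda>p. real (card (periodic_points L {1..n} p))) / real n"
    using conjugation_invariant_word_measure[OF w(3)]
      conjugation_invariant_word_measure[of "[(1, True)]" 1 n, folded unif_measure_eq_word_measure]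
    by (intro KR_dist_conjugation_invariant_le n L) auto
  also have "\<dots> \<le> 2 / real L + real (L * length w) ^ 2 / real n + real (L * length w) ^ 2 / real n"
  proof (intro add_mono divide_right_mono order_refl)
    show "measure_pmf.expectation (word_measure n r w) (\<lambda>p. real (card (periodic_points L {1..n} p)))
        \<le> real (L * length w) ^ 2"
      by (rule expectation_periodic_points_word_measure[OF w L])
    have "measure_pmf.expectation (unif_measure n) (\<lambda>p. real (card (periodic_points L {1..n} p)))
        \<le> real (L * length [(1::nat, True)]) ^ 2"
      unfolding unif_measure_eq_word_measure
      by (rule expectation_periodic_points_word_measure[OF _ _ _ L]) (auto simp: reduced_def)
    also have "\<dots> \<le> real (L * length w) ^ 2"
      using w(2) by (intro power_mono of_nat_mono mult_left_mono) (auto simp: Suc_le_eq)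
    finally show "measure_pmf.expectation (unif_measure n) (\<lambda>p. real (card (periodic_points L {1..n} p)))
        \<le> real (L * length w) ^ 2" .
  qed auto
  finally show ?thesis by simp
qed

theorem corollary1p3:
  fixes \<epsilon> :: real
  assumes "\<epsilon> > 0"
  shows "\<exists>c::real. c > 0 \<and>
    (\<forall>n::nat. \<forall>r::nat. \<forall>w. n \<ge> 1 \<longrightarrow> r \<ge> 1 \<longrightarrow>
       w \<in> carrier (free_group r) \<longrightarrow> w \<noteq> \<one>\<^bsub>free_group r\<^esub> \<longrightarrow>
       KR_dist (carrier (sym_group n)) (hamming_dist n) (word_measure n r w) (unif_measure n)
         \<le> c * real (length w) ^ 2 * real n powr (- (1 / 3) + \<epsilon>))"
proof (intro exI[of _ 10] conjI allI impI)
  fix n r :: nat and w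
  assume n: "n \<ge> 1" and "w \<in> carrier (free_group r)" "w \<noteq> \<one>\<^bsub>free_group r\<^esub>"
  then have w: "reduced w" "w \<noteq> []" "fst ` set w \<subseteq> {1..r}"
    by (auto simp: free_group_def)
  \<comment> \<open>\<open>L\<close> of order \<open>n powr (1 / 3)\<close> balances \<open>1 / L\<close> against \<open>L ^ 2 / n\<close>. A factor \<open>l powr (- 2 / 3)\<close> in
    \<open>L\<close> would improve the dependence on the length \<open>l\<close> to \<open>l powr (2 / 3)\<close>.\<close>
  define t where "t = real n powr (1 / 3)"
  define l where "l = real (length w)"
  define L where "L = nat \<lceil>t\<rceil>"
  have t: "t \<ge> 1" using n by (simp add: t_def ge_one_powr_ge_zero)
  have l: "l \<ge> 1" using w(2) by (simp add: l_def Suc_le_eq)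
  have t3: "t ^ 3 = real n" using n by (simp add: t_def powr_power)
  have L: "L \<ge> 1" "t \<le> real L" "real L \<le> 2 * t"
    using t by (simp_all add: L_def) linarith+
  have "KR_dist (carrier (sym_group n)) (hamming_dist n) (word_measure n r w) (unif_measure n)
      \<le> 2 / real L + 2 * real (L * length w) ^ 2 / real n"
    by (rule KR_dist_word_measure_le[OF w n L(1)])
  also have "\<dots> \<le> 2 / t + 2 * (2 * t * l) ^ 2 / t ^ 3"
  proof (rule add_mono)
    show "2 / real L \<le> 2 / t" using t L by (intro divide_left_mono) auto
    have "real (L * length w) \<le> 2 * t * l" 
      using mult_right_mono[OF L(3), of l] l unfolding l_def of_nat_mult by linarith
    then have "real (L * length w) ^ 2 \<le> (2 * t * l) ^ 2" by (rule power_mono) simp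
    then show "2 * real (L * length w) ^ 2 / real n \<le> 2 * (2 * t * l) ^ 2 / t ^ 3"
      unfolding t3 by (intro divide_right_mono mult_left_mono) simp_all
  qed
  also have "\<dots> = (2 + 8 * l ^ 2) / t"
    using t by (simp add: field_simps power2_eq_square power3_eq_cube)
  also have "\<dots> \<le> 10 * l ^ 2 / t"
    using t l by (intro divide_right_mono) auto
  also have "\<dots> = 10 * l ^ 2 * real n powr (- (1 / 3))"
    by (simp only: t_def powr_minus divide_inverse)
  also have "\<dots> \<le> 10 * l ^ 2 * real n powr (- (1 / 3) + \<epsilon>)"
    using n assms by (intro mult_left_mono powr_mono) auto
  finally show "KR_dist (carrier (sym_group n)) (hamming_dist n) (word_measure n r w) (unif_measure n)
      \<le> 10 * real (length w) ^ 2 * real n powr (- (1 / 3) + \<epsilon>)"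
    by (simp add: l_def)
qed simp

end
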